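(* Fix $N\ge1$. Let $T$ be a set of prefixes for $\mathrm{Av}_N(231)$ of sizes in $\{0,1,\dots,N-1\}$ (the empty prefix of size $0$ allowed) such that every $\pi\in\mathrm{Av}_N(231)$ has exactly one $i\in\{0,\dots,N-1\}$ with $\pi|_{[i]}\in T$. Then the trigger strategy with trigger set $T$ is optimal for the restricted game of best choice on $\mathrm{Av}_N(231)$. In particular, for every $k\in\{0,1,\dots,N-1\}$, the positional strategy that rejects the first $k$ candidates and accepts the next candidate that is a left-to-right maximum is optimal.
   Context: $\mathrm{Av}_N(231)$ is the set of permutations $\pi=\pi_1\cdots\pi_N$ of $[N]$ with no indices $a<b<c$ such that $\pi_c<\pi_a<\pi_b$. The $i$th prefix flattening $\pi|_{[i]}$ is the permutation of $[i]$ in the same relative order as $\pi_1,\dots,\pi_i$ ($\pi|_{[0]}$ is the empty prefix). A prefix of size $i$ is any $\pi|_{[i]}$ with $\pi\in\mathrm{Av}_N(231)$. An entry $\pi_j$ is a left-to-right maximum if $\pi_j>\pi_l$ for all $l<j$ (this is determined by $\pi|_{[j]}$). The trigger strategy with trigger set $T$: let $i$ be the index with $\pi|_{[i]}\in T$; reject candidates $1,\dots,i$ and accept the first candidate $j>i$ such that $\pi_j$ is a left-to-right maximum (if there is none, the last candidate is accepted). The restricted game of best choice on a set $I_N$: $\pi$ is chosen uniformly at random from $I_N$; for $i=1,2,\dots$ the player is shown $\pi|_{[i]}$ and, using only $\pi|_{[1]},\dots,\pi|_{[i]}$, accepts candidate $i$ (ending the game) or rejects it forever; if all earlier candidates are rejected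 candidate $N$ is accepted; the player wins iff the accepted candidate $i$ has $\pi_i=N$. A strategy is optimal if it maximizes the winning probability. *)

theory Defs
  imports "HOL-Probability.Probability" "HOL-Combinatorics.Multiset_Permutations"
begin

text \<open>
  A permutation \<open>\<pi>\<^sub>1 \<dots> \<pi>\<^sub>N\<close> of \<open>{1..N}\<close> is the list of its entries. Candidates are
  numbered from 1, so the entry \<open>\<pi>\<^sub>i\<close> is \<open>p ! (i - 1)\<close>.
\<close>

definition contains_231 :: "nat list \<Rightarrow> bool" where
  "contains_231 p \<longleftrightarrow>
     (\<exists>a b c. a < b \<and> b < c \<and> c < length p \<and> p ! c < p ! a \<and> p ! a < p ! b)"

definition Av231 :: "nat \<Rightarrow> nat list set" where
  "Av231 N = {p \<in> permutations_of_set {1..N}. \<not> contains_231 p}"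

definition flatten :: "nat list \<Rightarrow> nat list" where
  "flatten xs = map (\<lambda>x. card {y \<in> set xs. y \<le> x}) xs"

definition prefix_flattening :: "nat list \<Rightarrow> nat \<Rightarrow> nat list" where
  "prefix_flattening p i = flatten (take i p)"

definition lr_max :: "nat list \<Rightarrow> nat \<Rightarrow> bool" where
  "lr_max p j \<longleftrightarrow> (\<forall>l\<in>{1..<j}. p ! (l - 1) < p ! (j - 1))"


subsection \<open>The restricted game of best choice\<close>

text \<open>
  When deciding on candidate \<open>i\<close>, the player has seen the prefix flattenings of sizes
  \<open>1, \<dots>, i\<close>. A strategy maps this history to the decision whether to accept candidate \<open>i\<close>.
\<close>

definition history :: "nat list \<Rightarrow> nat \<Rightarrow> nat list list" where
  "history p i = map (prefix_flattening p) [1..<Suc i]"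

type_synonym strategy = "nat list list \<Rightarrow> bool"

definition accepted :: "nat \<Rightarrow> strategy \<Rightarrow> nat list \<Rightarrow> nat" where
  "accepted N s p =
     (if \<exists>i\<in>{1..N}. s (history p i) then LEAST i. i \<in> {1..N} \<and> s (history p i) else N)"

definition win_prob :: "nat \<Rightarrow> nat list set \<Rightarrow> strategy \<Rightarrow> real" where
  "win_prob N I s = measure_pmf.prob (pmf_of_set I) {p. p ! (accepted N s p - 1) = N}"

definition optimal :: "nat \<Rightarrow> nat list set \<Rightarrow> strategy \<Rightarrow> bool" where
  "optimal N I s \<longleftrightarrow> (\<forall>s'. win_prob N I s' \<le> win_prob N I s)"


subsection \<open>Trigger strategies and positional strategies\<close>

definition prefixes_Av231 :: "nat \<Rightarrow> nat list set" where
  "prefixes_Av231 N = {prefix_flattening p i | p i. p \<in> Av231 N \<and> i < N}"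

definition trigger_set :: "nat \<Rightarrow> nat list set \<Rightarrow> bool" where
  "trigger_set N T \<longleftrightarrow>
     T \<subseteq> prefixes_Av231 N \<and>
     (\<forall>p\<in>Av231 N. \<exists>!i. i < N \<and> prefix_flattening p i \<in> T)"

text \<open>
  At candidate \<open>j\<close> of \<open>p\<close>, the history \<open>h\<close> has length \<open>j\<close>, its last element is the prefix
  flattening of size \<open>j\<close>, and \<open>([] # h) ! i\<close> is the one of size \<open>i\<close> for every \<open>i \<le> j\<close>,
  including the empty prefix. Since \<^term>\<open>accepted\<close> takes the first accepting decision, the
  lemmas at the end of this theory give the intended accepted candidates.
\<close>

definition trigger_strategy :: "nat list set \<Rightarrow> strategy" where
  "trigger_strategy T h \<longleftrightarrow>
     (\<exists>i<length h. ([] # h) ! i \<in> T) \<and> lr_max (last h) (length h)"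

definition positional_strategy :: "nat \<Rightarrow> strategy" where
  "positional_strategy k h \<longleftrightarrow> k < length h \<and> lr_max (last h) (length h)"


subsection \<open>Sanity checks\<close>

lemma length_flatten [simp]: "length (flatten xs) = length xs"
  by (simp add: flatten_def)

lemma flatten_less_iff:
  assumes "a < length xs" "b < length xs"
  shows "flatten xs ! a < flatten xs ! b \<longleftrightarrow> xs ! a < xs ! b"
proof -
  define f where "f = (\<lambda>x. card {y \<in> set xs. y \<le> x})"
  have mono: "f x \<le> f z" if "x \<le> z" for x z
    unfolding f_def using that by (intro card_mono) auto
  have smono: "f x < f z" if "x < z" "z \<in> set xs" for x z
    unfolding f_def using that by (intro psubset_card_mono) force+
  have "f (xs ! a) < f (xs ! b) \<longleftrightarrow> xs ! a < xs ! b"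
    using mono smono assms by (metis leD leI nth_mem)
  then show ?thesis
    using assms by (simp add: flatten_def f_def)
qed

lemma flatten_permutation:
  assumes "distinct xs"
  shows "flatten xs \<in> permutations_of_set {1..length xs}"
proof -
  have "distinct (flatten xs)"
    unfolding distinct_conv_nth
  proof (intro allI impI)
    fix a b assume "a < length (flatten xs)" "b < length (flatten xs)" "a \<noteq> b"
    then show "flatten xs ! a \<noteq> flatten xs ! b"
      using flatten_less_iff[of a xs b] flatten_less_iff[of b xs a] assms
      by (metis length_flatten less_irrefl linorder_neqE_nat nth_eq_iff_index_eq)
  qed
  moreover have sub: "set (flatten xs) \<subseteq> {1..length xs}"
  proof
    fix v assume "v \<in> set (flatten xs)"
    then obtain x where x: "x \<in> set xs" "v = card {y \<in> set xs. y \<le> x}"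
      by (auto simp: flatten_def)
    have "v > 0" using x by (auto simp: card_gt_0_iff)
    moreover have "v \<le> card (set xs)" unfolding x by (intro card_mono) auto
    ultimately show "v \<in> {1..length xs}"
      using card_length[of xs] by auto
  qed
  ultimately have "set (flatten xs) = {1..length xs}"
    by (intro card_subset_eq) (auto simp: distinct_card)
  with \<open>distinct (flatten xs)\<close> show ?thesis
    by (simp add: permutations_of_set_def)
qed

lemma length_history [simp]: "length (history p j) = j"
  by (simp add: history_def)

lemma last_history: "j \<ge> 1 \<Longrightarrow> last (history p j) = prefix_flattening p j"
  by (simp add: history_def)

lemma nth_history: "i \<le> j \<Longrightarrow> ([] # history p j) ! i = prefix_flattening p i"
  by (cases i) (auto simp: history_def prefix_flattening_def flatten_def
      simp del: upt_Suc)

lemma lr_max_prefix_flattening: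
  assumes "j \<in> {1..length p}"
  shows "lr_max (prefix_flattening p j) j \<longleftrightarrow> lr_max p j"
  unfolding lr_max_def prefix_flattening_def
proof (intro ball_cong refl)
  fix l assume "l \<in> {1..<j}"
  then show "(flatten (take j p) ! (l - 1) < flatten (take j p) ! (j - 1)) =
      (p ! (l - 1) < p ! (j - 1))"
    using assms flatten_less_iff[of "l - 1" "take j p" "j - 1"] by auto
qed

lemma accepted_positional:
  assumes "length p = N"
  shows "accepted N (positional_strategy k) p =
    (if \<exists>j\<in>{k<..N}. lr_max p j then LEAST j. j \<in> {k<..N} \<and> lr_max p j else N)"
proof -
  have "i \<in> {1..N} \<and> positional_strategy k (history p i) \<longleftrightarrow> i \<in> {k<..N} \<and> lr_max p i" for i
    using assms lr_max_prefix_flattening[of i p]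
    by (auto simp: positional_strategy_def last_history)
  then show ?thesis
    unfolding accepted_def by (simp only: Bex_def)
qed

lemma accepted_trigger:
  assumes "trigger_set N T" "p \<in> Av231 N" "i < N" "prefix_flattening p i \<in> T"
  shows "accepted N (trigger_strategy T) p =
    (if \<exists>j\<in>{i<..N}. lr_max p j then LEAST j. j \<in> {i<..N} \<and> lr_max p j else N)"
proof -
  have len: "length p = N"
    using assms(2) by (auto simp: Av231_def permutations_of_set_def dest: distinct_card)
  have uniq: "i' = i" if "i' < N" "prefix_flattening p i' \<in> T" for i'
    using assms that unfolding trigger_set_def by blast
  have "(\<exists>i'<j. ([] # history p j) ! i' \<in> T) \<longleftrightarrow> i < j" if "j \<le> N" for j
    using that uniq assms(4) nth_history[of _ j p]
    by (metis less_imp_le_nat less_le_trans)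
  then have "j \<in> {1..N} \<and> trigger_strategy T (history p j) \<longleftrightarrow> j \<in> {i<..N} \<and> lr_max p j" for j
    using lr_max_prefix_flattening[of j p] len
    by (auto simp: trigger_strategy_def last_history)
  then show ?thesis
    unfolding accepted_def by (simp only: Bex_def)
qed

end

theory Submission imports Defs begin

text \<open>
  Deleting the maximum \<open>N\<close> maps \<open>Av\<^sub>N(231)\<close> onto \<open>Av\<^sub>N\<^sub>-\<^sub>1(231)\<close>. The permutations over a given \<open>\<tau>\<close>
  arise by inserting \<open>N\<close> directly before a left-to-right maximum of \<open>\<tau>\<close> or at the end, and
  inserting at position \<open>i < N\<close> leaves all prefix flattenings of sizes up to \<open>i\<close> unchanged. Hence a
  strategy that wins after insertion at \<open>i\<close> also accepts \<open>i\<close> after any later insertion, so every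
  strategy wins on at most one permutation over each \<open>\<tau>\<close>. A trigger strategy wins on exactly one:
  insert \<open>N\<close> before the first left-to-right maximum of \<open>\<tau>\<close> after the trigger, or at the end.
\<close>

section \<open>Inserting one element into a list\<close>

definition insert_at :: "nat \<Rightarrow> 'a \<Rightarrow> 'a list \<Rightarrow> 'a list" where
  "insert_at m x xs = take m xs @ x # drop m xs"

lemma length_insert_at [simp]: "length (insert_at m x xs) = Suc (length xs)"
  by (simp add: insert_at_def)

lemma set_insert_at [simp]: "set (insert_at m x xs) = insert x (set xs)"
  using set_append[of "take m xs" "drop m xs"] by (simp add: insert_at_def)

lemma distinct_insert_at [simp]: "distinct (insert_at m x xs) \<longleftrightarrow> x \<notin> set xs \<and> distinct xs"
proof -
  have "distinct (insert_at m x xs) \<longleftrightarrow> distinct (x # take m xs @ drop m xs)"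
    unfolding insert_at_def by (simp del: append_take_drop_id) blast
  then show ?thesis by simp
qed

lemma nth_insert_at:
  assumes "m \<le> length xs"
  shows "insert_at m x xs ! i = (if i < m then xs ! i else if i = m then x else xs ! (i - 1))"
proof -
  consider "i < m" | "i = m" | k where "i = Suc (m + k)"
    by (metis less_iff_Suc_add linorder_neqE_nat)
  then show ?thesis
    using assms by cases (auto simp: insert_at_def nth_append)
qed

lemma take_insert_at: "j \<le> m \<Longrightarrow> m \<le> length xs \<Longrightarrow> take j (insert_at m x xs) = take j xs"
  by (simp add: insert_at_def min_absorb1)

lemma remove1_insert_at: "x \<notin> set xs \<Longrightarrow> remove1 x (insert_at m x xs) = xs"
  by (auto simp: insert_at_def remove1_append dest: in_set_takeD)

lemma insert_at_remove1:
  assumes "distinct xs" "m < length xs" "xs ! m = x"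
  shows "insert_at m x (remove1 x xs) = xs"
proof -
  have xs: "xs = take m xs @ x # drop (Suc m) xs"
    using assms id_take_nth_drop by blast
  with assms(1) have "x \<notin> set (take m xs)"
    by (metis disjoint_insert(2) distinct_append list.simps(15))
  then have "remove1 x xs = take m xs @ drop (Suc m) xs"
    by (subst xs) (simp add: remove1_append)
  then have "insert_at m x (remove1 x xs) = take m xs @ x # drop (Suc m) xs"
    using assms(2) by (simp add: insert_at_def)
  then show ?thesis using xs by metis
qed

section \<open>Patterns 231 under insertion\<close>

lemma contains_231_insert_at:
  assumes "m \<le> length xs" "contains_231 xs"
  shows "contains_231 (insert_at m x xs)"
proof -
  \<comment> \<open>\<open>f\<close> sends each index of \<open>xs\<close> to the index of the same
    entry after the insertion, skipping \<open>m\<close>.\<close>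
  define f where "f i = (if i < m then i else Suc i)" for i
  have nth: "insert_at m x xs ! f i = xs ! i" for i
    using assms(1) by (auto simp: nth_insert_at f_def)
  obtain a b c where abc: "a < b" "b < c" "c < length xs" "xs ! c < xs ! a" "xs ! a < xs ! b"
    using assms(2) unfolding contains_231_def by blast
  have "f a < f b" "f b < f c" "f c < length (insert_at m x xs)"
    using abc by (auto simp: f_def)
  moreover have "insert_at m x xs ! f c < insert_at m x xs ! f a"
    "insert_at m x xs ! f a < insert_at m x xs ! f b"
    using abc by (simp_all add: nth)
  ultimately show ?thesis
    unfolding contains_231_def by blast
qed

text \<open>A new maximum can only be the largest letter of a 231 pattern, and \<open>less\<close>
  rules that out, since every entry before it is below every entry after it. So any occurrence
  avoids index \<open>m\<close> and shifts back to \<open>xs\<close> along \<open>g\<close>.\<close>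

lemma contains_231_insert_maxD:
  assumes m: "m \<le> length xs" and max: "\<forall>y\<in>set xs. y < x"
    and less: "\<And>i j. i < m \<Longrightarrow> m \<le> j \<Longrightarrow> j < length xs \<Longrightarrow> xs ! i < xs ! j"
    and con: "contains_231 (insert_at m x xs)"
  shows "contains_231 xs"
proof -
  let ?p = "insert_at m x xs"
  define g where "g i = (if i < m then i else i - 1)" for i
  obtain a b c where abc: "a < b" "b < c" "c < length ?p" "?p ! c < ?p ! a" "?p ! a < ?p ! b"
    using con unfolding contains_231_def by blast
  have le: "?p ! i \<le> x" if "i < length ?p" for i
    using nth_mem[OF that] max by auto
  have x: "?p ! m = x"
    using m by (simp add: nth_insert_at)
  have am: "a \<noteq> m" and cm: "c \<noteq> m"
    using abc le[of a] le[of b] x by (auto simp: not_le[symmetric])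
  have "b \<noteq> m"
  proof
    assume "b = m"
    then have "a < m" "m < c" "m \<le> c - 1" "c - 1 < length xs" using abc by auto
    then show False
      using less[of a "c - 1"] abc(4) m by (simp add: nth_insert_at)
  qed
  have nth: "?p ! i = xs ! g i" if "i \<noteq> m" for i
    using that m by (simp add: nth_insert_at g_def)
  have "g a < g b" "g b < g c" "g c < length xs"
    using abc am cm \<open>b \<noteq> m\<close> m by (auto simp: g_def)
  moreover have "xs ! g c < xs ! g a" "xs ! g a < xs ! g b"
    using abc nth am cm \<open>b \<noteq> m\<close> by auto
  ultimately show ?thesis
    unfolding contains_231_def by blast
qed

section \<open>Inserting and deleting the maximum in \<open>Av231\<close>\<close>

lemma Av231_iff:
  "p \<in> Av231 N \<longleftrightarrow> set p = {1..N} \<and> distinct p \<and> \<not> contains_231 p"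
  by (auto simp: Av231_def permutations_of_set_def)

lemma length_Av231: "p \<in> Av231 N \<Longrightarrow> length p = N"
  by (auto simp: Av231_iff dest: distinct_card)

lemma finite_Av231 [simp]: "finite (Av231 N)"
  by (simp add: Av231_def)

lemma Av231_nonempty: "Av231 N \<noteq> {}"
proof -
  have "[1..<Suc N] \<in> Av231 N"
    by (auto simp: Av231_iff contains_231_def simp del: upt_Suc)
  then show ?thesis by blast
qed

lemma lr_max_Suc: "lr_max p (Suc m) \<longleftrightarrow> (\<forall>l<m. p ! l < p ! m)"
proof -
  have "{1..<Suc m} = Suc ` {..<m}"
    by (simp add: lessThan_atLeast0 image_Suc_atLeastLessThan)
  then show ?thesis
    by (auto simp: lr_max_def)
qed

text \<open>
  Here and below \<open>m\<close> is a list index, so that the inserted maximum is candidate \<open>Suc m\<close>;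
  \<open>m = M\<close> inserts it at the end.
\<close>

lemma insert_at_in_Av231:
  assumes q: "q \<in> Av231 M" and m: "m \<le> M" "m < M \<longrightarrow> lr_max q (Suc m)"
  shows "insert_at m (Suc M) q \<in> Av231 (Suc M)"
proof -
  have len: "length q = M" and set: "set q = {1..M}" and av: "\<not> contains_231 q" and "distinct q"
    using q by (auto simp: Av231_iff length_Av231)
  have less: "q ! i < q ! j" if ij: "i < m" "m \<le> j" "j < length q" for i j
  proof (cases "j = m")
    case True
    then show ?thesis using m ij len by (simp add: lr_max_Suc)
  next
    case False
    then have "m < j" using ij by simp
    have "q ! i < q ! m" using m ij len by (simp add: lr_max_Suc)
    \<comment> \<open>Otherwise the indices \<open>i\<close>, \<open>m\<close>, \<open>j\<close>
      carry a 231 pattern of \<open>q\<close>.\<close>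
    then have "\<not> q ! j < q ! i"
      using av ij \<open>m < j\<close> unfolding contains_231_def by blast
    moreover have "q ! j \<noteq> q ! i"
      using \<open>distinct q\<close> ij \<open>m < j\<close> by (simp add: nth_eq_iff_index_eq)
    ultimately show ?thesis by simp
  qed
  have "\<not> contains_231 (insert_at m (Suc M) q)"
    using contains_231_insert_maxD[of m q "Suc M"] less m av len set by auto
  then show ?thesis
    using \<open>distinct q\<close> set by (auto simp: Av231_iff)
qed

text \<open>This is the converse of the insertion lemma. An entry before the maximum that exceeds
  the entry right after it would complete a 231 pattern with these two, so after the deletion the
  follower is a left-to-right maximum.\<close>

lemma remove_max_Av231:
  assumes p: "p \<in> Av231 (Suc M)" and m: "m \<le> M" "p ! m = Suc M"
  defines "q \<equiv> remove1 (Suc M) p"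
  shows "q \<in> Av231 M" "p = insert_at m (Suc M) q" "m < M \<Longrightarrow> lr_max q (Suc m)"
proof -
  have len: "length p = Suc M" and set: "set p = {1..Suc M}" and av: "\<not> contains_231 p"
    and dist: "distinct p"
    using p by (auto simp: Av231_iff length_Av231)
  show pq: "p = insert_at m (Suc M) q"
    unfolding q_def using m len by (intro insert_at_remove1[OF dist, symmetric]) auto
  have lenq: "length q = M"
    unfolding q_def using len set by (simp add: length_remove1)
  have "set q = {1..M}"
    unfolding q_def set_remove1_eq[OF dist] set by auto
  moreover have "distinct q" unfolding q_def by (rule distinct_remove1[OF dist])
  moreover have "\<not> contains_231 q"
    using contains_231_insert_at[of m q "Suc M"] av m(1) unfolding lenq pq[symmetric] by blast
  ultimately show "q \<in> Av231 M" by (simp add: Av231_iff)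
  assume "m < M"
  show "lr_max q (Suc m)"
    unfolding lr_max_Suc
  proof (intro allI impI)
    fix l assume "l < m"
    have "p ! l \<in> set p" using \<open>l < m\<close> \<open>m < M\<close> len by simp
    moreover have "p ! l \<noteq> p ! m"
      using dist \<open>l < m\<close> \<open>m < M\<close> len by (simp add: nth_eq_iff_index_eq)
    ultimately have "p ! l < p ! m" using m set by auto
    \<comment> \<open>Indices \<open>l\<close>, \<open>m\<close>, \<open>Suc m\<close> are tested
      for the pattern; \<open>p ! Suc m\<close> is the later \<open>q ! m\<close>.\<close>
    moreover have "\<not> (p ! l < p ! m \<and> p ! Suc m < p ! l)"
      using av \<open>l < m\<close> \<open>m < M\<close> len unfolding contains_231_def
      by (metis Suc_less_eq lessI)
    moreover have "p ! Suc m \<noteq> p ! l"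
      using dist \<open>l < m\<close> \<open>m < M\<close> len by (simp add: nth_eq_iff_index_eq)
    ultimately have "p ! l < p ! Suc m" by simp
    then show "q ! l < q ! m"
      using nth_insert_at[of m q "Suc M"] lenq \<open>l < m\<close> \<open>m < M\<close> unfolding pq[symmetric] by simp
  qed
qed

section \<open>Prefix flattenings under insertion of the maximum\<close>

lemma flatten_snoc_max:
  assumes "\<forall>z\<in>set xs. z < x"
  shows "flatten (xs @ [x]) = flatten xs @ [Suc (card (set xs))]"
proof -
  have "{y \<in> set (xs @ [x]). y \<le> z} = {y \<in> set xs. y \<le> z}" if "z \<in> set xs" for z
    using assms that by fastforce
  moreover have "{y \<in> set (xs @ [x]). y \<le> x} = insert x (set xs)" "x \<notin> set xs"
    using assms by (auto simp: less_imp_le)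
  ultimately show ?thesis
    by (simp add: flatten_def cong: map_cong)
qed

text \<open>The essential case is size \<open>Suc m\<close>: both \<open>Suc M\<close> and the
  left-to-right maximum it displaces exceed the same \<open>m\<close> earlier entries, so flattening
  cannot tell them apart.\<close>

lemma prefix_flattening_insert_at:
  assumes q: "q \<in> Av231 M" and m: "m < M" "lr_max q (Suc m)" and j: "j \<le> Suc m"
  shows "prefix_flattening (insert_at m (Suc M) q) j = prefix_flattening q j"
proof (cases "j = Suc m")
  case False
  then show ?thesis
    using j m length_Av231[OF q] by (simp add: prefix_flattening_def take_insert_at)
next
  case True
  have len: "length q = M" and set: "set q = {1..M}"
    using q by (auto simp: Av231_iff length_Av231)
  have "\<forall>z\<in>set (take m q). z < q ! m"
    using m len by (auto simp: lr_max_Suc in_set_conv_nth)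
  moreover have "\<forall>z\<in>set (take m q). z < Suc M"
    using set by (auto dest!: in_set_takeD)
  moreover have "take (Suc m) (insert_at m (Suc M) q) = take m q @ [Suc M]"
    using m len by (simp add: insert_at_def)
  ultimately show ?thesis
    using m len True by (simp add: prefix_flattening_def take_Suc_conv_app_nth flatten_snoc_max)
qed

section \<open>The accepted candidate\<close>

lemma accepted_bounds: "N \<ge> 1 \<Longrightarrow> accepted N s p \<in> {1..N}"
proof (cases "\<exists>i\<in>{1..N}. s (history p i)")
  case True
  then have "(LEAST i. i \<in> {1..N} \<and> s (history p i)) \<in> {1..N}"
    using LeastI_ex[of "\<lambda>i. i \<in> {1..N} \<and> s (history p i)"] by blast
  then show ?thesis using True unfolding accepted_def by simp
qed (auto simp: accepted_def)

text \<open>The strict bound excludes the default value \<open>N\<close>, so the acceptance was a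
  decision of \<open>s\<close>.\<close>

lemma accepted_less_decision:
  assumes "accepted N s p < N"
  shows "accepted N s p \<ge> 1" "s (history p (accepted N s p))"
proof -
  have ex: "\<exists>i. i \<in> {1..N} \<and> s (history p i)"
    using assms unfolding accepted_def by (auto split: if_splits)
  then have "accepted N s p = (LEAST i. i \<in> {1..N} \<and> s (history p i))"
    unfolding accepted_def by auto
  then show "accepted N s p \<ge> 1" "s (history p (accepted N s p))"
    using LeastI_ex[OF ex] by auto
qed

lemma accepted_le:
  assumes "i \<in> {1..N}" "s (history p i)"
  shows "accepted N s p \<le> i"
proof -
  have "accepted N s p = (LEAST i. i \<in> {1..N} \<and> s (history p i))"
    using assms unfolding accepted_def by auto
  then show ?thesis using assms by (simp add: Least_le)
qed

section \<open>Counting winning permutations by deleting the maximum\<close>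

definition wins :: "nat \<Rightarrow> strategy \<Rightarrow> nat list set" where
  "wins N s = {p \<in> Av231 N. p ! (accepted N s p - 1) = N}"

lemma finite_wins [simp]: "finite (wins N s)"
  by (simp add: wins_def)

lemma win_prob_Av231: "win_prob N (Av231 N) s = card (wins N s) / card (Av231 N)"
proof -
  have "Av231 N \<inter> {p. p ! (accepted N s p - 1) = N} = wins N s"
    by (auto simp: wins_def)
  then show ?thesis
    by (simp add: win_prob_def measure_pmf_of_set Av231_nonempty)
qed

lemma card_wins_le: "card (wins (Suc M) s) \<le> card (Av231 M)"
proof (rule card_inj_on_le)
  define acc where "acc = accepted (Suc M) s"
  have win: "p \<in> Av231 (Suc M)" "1 \<le> acc p" "acc p - 1 \<le> M" "p ! (acc p - 1) = Suc M"
    if "p \<in> wins (Suc M) s" for p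
    using that accepted_bounds[of "Suc M" s p] by (auto simp: wins_def acc_def)
  show "remove1 (Suc M) ` wins (Suc M) s \<subseteq> Av231 M"
    using win remove_max_Av231(1) by blast
  have not_less: "\<not> acc p < acc p'"
    if p: "p \<in> wins (Suc M) s" and p': "p' \<in> wins (Suc M) s"
      and eq: "remove1 (Suc M) p = remove1 (Suc M) p'" for p p'
  proof
    assume less: "acc p < acc p'"
    define q where "q = remove1 (Suc M) p"
    note w = win[OF p] and w' = win[OF p']
    have q: "q \<in> Av231 M" "p = insert_at (acc p - 1) (Suc M) q"
      and lr: "acc p - 1 < M \<Longrightarrow> lr_max q (Suc (acc p - 1))"
      using remove_max_Av231[OF w(1) w(3,4)] unfolding q_def by auto
    have p'_eq: "p' = insert_at (acc p' - 1) (Suc M) q"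
      using remove_max_Av231(2)[OF w'(1) w'(3,4)] eq unfolding q_def by simp
    have le: "acc p \<le> M" "acc p - 1 < M" using less w w' by auto
    have "prefix_flattening p j = prefix_flattening p' j" if "j \<le> acc p" for j
    proof -
      \<comment> \<open>This includes \<open>j = acc p\<close>, where the prefix of \<open>p\<close>
        already ends in \<open>Suc M\<close>.\<close>
      have "prefix_flattening p j = prefix_flattening q j"
        using prefix_flattening_insert_at[OF q(1) le(2) lr[OF le(2)], of j] that w(2) q(2) by simp
      \<comment> \<open>By strictness of \<open>less\<close>, the first \<open>j\<close> entries of
        \<open>p'\<close> end before its maximum.\<close>
      moreover have "j \<le> acc p' - 1" using that less by simp
      then have "take j p' = take j q"
        using take_insert_at[of j "acc p' - 1" q] length_Av231[OF q(1)] w'(3) by (subst p'_eq) simp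
      ultimately show ?thesis by (simp add: prefix_flattening_def)
    qed
    then have "history p (acc p) = history p' (acc p)"
      by (auto simp: history_def simp del: upt_Suc)
    \<comment> \<open>As \<open>acc p \<le> M\<close>, candidate \<open>acc p\<close> is not the
      default, so \<open>s\<close> accepts it on the common history.\<close>
    then have "s (history p' (acc p))"
      using accepted_less_decision(2)[of "Suc M" s p] le unfolding acc_def by simp
    then have "acc p' \<le> acc p"
      using accepted_le[of "acc p" "Suc M" s p'] w le unfolding acc_def by simp
    with less show False by simp
  qed
  show "inj_on (remove1 (Suc M)) (wins (Suc M) s)"
  proof (rule inj_onI)
    fix p p' assume p: "p \<in> wins (Suc M) s" and p': "p' \<in> wins (Suc M) s"
      and eq: "remove1 (Suc M) p = remove1 (Suc M) p'"
    have "acc p = acc p'"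
      using not_less[OF p p' eq] not_less[OF p' p eq[symmetric]] by simp
    then show "p = p'"
      using remove_max_Av231(2)[OF win(1,3,4)[OF p]] remove_max_Av231(2)[OF win(1,3,4)[OF p']] eq
      by metis
  qed
qed simp

lemma card_wins_trigger_ge:
  assumes T: "trigger_set (Suc M) T"
  shows "card (Av231 M) \<le> card (wins (Suc M) (trigger_strategy T))"
proof -
  have "Av231 M \<subseteq> remove1 (Suc M) ` wins (Suc M) (trigger_strategy T)"
  proof
    fix q assume q: "q \<in> Av231 M"
    note len = length_Av231[OF q]
    \<comment> \<open>Insertion at the end only serves to find the trigger size \<open>i\<close>: as
      \<open>i \<le> M\<close>, the triggering prefix is one of \<open>q\<close> itself.\<close>
    have "insert_at M (Suc M) q \<in> Av231 (Suc M)"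
      using insert_at_in_Av231[OF q] by simp
    then obtain i where i: "i < Suc M" "prefix_flattening (insert_at M (Suc M) q) i \<in> T"
      using T unfolding trigger_set_def by blast
    \<comment> \<open>The value \<open>M\<close> always qualifies, which makes the minimum exist and
      covers the case of no left-to-right maximum of \<open>q\<close> after the trigger.\<close>
    define m where "m = (LEAST m. i \<le> m \<and> (m < M \<longrightarrow> lr_max q (Suc m)))"
    have ex: "i \<le> M \<and> (M < M \<longrightarrow> lr_max q (Suc M))" using i by simp
    have m: "i \<le> m" "m < M \<longrightarrow> lr_max q (Suc m)" "m \<le> M"
      using LeastI[of "\<lambda>m. i \<le> m \<and> (m < M \<longrightarrow> lr_max q (Suc m))", OF ex]
        Least_le[of "\<lambda>m. i \<le> m \<and> (m < M \<longrightarrow> lr_max q (Suc m))", OF ex]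
      unfolding m_def by auto
    have first: "\<not> lr_max q (Suc k)" if "i \<le> k" "k < m" for k
      using not_less_Least[of k "\<lambda>m. i \<le> m \<and> (m < M \<longrightarrow> lr_max q (Suc m))"] that
      unfolding m_def by blast
    let ?p = "insert_at m (Suc M) q"
    have p: "?p \<in> Av231 (Suc M)" using insert_at_in_Av231[OF q m(3,2)] .
    have nth: "?p ! l = (if l < m then q ! l else if l = m then Suc M else q ! (l - 1))" for l
      using nth_insert_at[of m q] m len by simp
    \<comment> \<open>As \<open>i \<le> m\<close>, moving the insertion from \<open>M\<close> to
      \<open>m\<close> keeps the first \<open>i\<close> entries.\<close>
    have "prefix_flattening ?p i \<in> T"
      using i m len by (simp add: prefix_flattening_def take_insert_at)
    note acc = accepted_trigger[OF T p i(1) this]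
    have q_less: "q ! l < Suc M" if "l < M" for l
    proof -
      have "q ! l \<in> set q" using that len by simp
      then show ?thesis using q unfolding Av231_iff by auto
    qed
    have lr: "lr_max ?p (Suc m)"
      using m q_less by (auto simp: lr_max_Suc nth)
    have "(LEAST j. j \<in> {i<..Suc M} \<and> lr_max ?p j) = Suc m"
    proof (rule Least_equality)
      show "Suc m \<in> {i<..Suc M} \<and> lr_max ?p (Suc m)" using m lr by auto
      fix j assume j: "j \<in> {i<..Suc M} \<and> lr_max ?p j"
      show "Suc m \<le> j"
      proof (rule ccontr)
        assume "\<not> Suc m \<le> j"
        then obtain k where k: "j = Suc k" "i \<le> k" "k < m"
          using j by (cases j) auto
        \<comment> \<open>Before index \<open>m\<close> the lists \<open>?p\<close> and
          \<open>q\<close> coincide, so an earlier acceptance would contradict the minimality of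
          \<open>m\<close>.\<close>
        then have "lr_max q (Suc k)" using j by (auto simp: lr_max_Suc nth)
        then show False using first k by blast
      qed
    qed
    moreover have "\<exists>j\<in>{i<..Suc M}. lr_max ?p j"
      using lr m by (intro bexI[of _ "Suc m"]) auto
    ultimately have "accepted (Suc M) (trigger_strategy T) ?p = Suc m"
      using acc by simp
    then have "?p \<in> wins (Suc M) (trigger_strategy T)"
      using p by (simp add: wins_def nth)
    moreover have "remove1 (Suc M) ?p = q"
      using q by (intro remove1_insert_at) (auto simp: Av231_iff)
    ultimately show "q \<in> remove1 (Suc M) ` wins (Suc M) (trigger_strategy T)"
      by (metis imageI)
  qed
  then show ?thesis
    by (rule surj_card_le[rotated]) simp
qed

section \<open>Optimality of trigger and positional strategies\<close>

lemma optimal_trigger_strategy: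
  assumes "N \<ge> 1" "trigger_set N T"
  shows "optimal N (Av231 N) (trigger_strategy T)"
  unfolding optimal_def win_prob_Av231
proof
  fix s
  obtain M where "N = Suc M" using assms(1) by (cases N) auto
  then have "card (wins N s) \<le> card (wins N (trigger_strategy T))"
    using card_wins_le[of M s] card_wins_trigger_ge[of M T] assms(2) by simp
  then show "card (wins N s) / card (Av231 N) \<le> card (wins N (trigger_strategy T)) / card (Av231 N)"
    by (intro divide_right_mono) auto
qed

text \<open>The length of a prefix flattening is its size, so only size \<open>k\<close> can hit
  this set.\<close>

lemma trigger_set_size:
  assumes "k < N"
  shows "trigger_set N ((\<lambda>p. prefix_flattening p k) ` Av231 N)"
proof -
  have "i = k"
    if "p \<in> Av231 N" "p' \<in> Av231 N" "i < N" "prefix_flattening p i = prefix_flattening p' k"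
    for p p' i
    using arg_cong[OF that(4), of length] that(1-3) assms
    by (simp add: prefix_flattening_def length_Av231)
  then show ?thesis
    using assms unfolding trigger_set_def prefixes_Av231_def by blast
qed

lemma optimal_positional_strategy:
  assumes "k < N"
  shows "optimal N (Av231 N) (positional_strategy k)"
proof -
  let ?T = "(\<lambda>p. prefix_flattening p k) ` Av231 N"
  \<comment> \<open>The two strategies may differ on histories that no permutation in
    \<open>Av231 N\<close> produces, so accepted candidates are compared rather than the
    functions.\<close>
  have "accepted N (trigger_strategy ?T) p = accepted N (positional_strategy k) p"
    if "p \<in> Av231 N" for p
    using accepted_trigger[OF trigger_set_size[OF assms] that assms]
      accepted_positional[OF length_Av231[OF that]] that by simp
  then have "wins N (trigger_strategy ?T) = wins N (positional_strategy k)"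
    by (auto simp: wins_def)
  then show ?thesis
    using optimal_trigger_strategy[OF _ trigger_set_size[OF assms]] assms
    by (simp add: optimal_def win_prob_Av231)
qed

theorem theorem3p5:
  fixes N :: nat
  assumes "N \<ge> 1"
  shows "(\<forall>T. trigger_set N T \<longrightarrow> optimal N (Av231 N) (trigger_strategy T)) \<and>
         (\<forall>k\<in>{0..N - 1}. optimal N (Av231 N) (positional_strategy k))"
  using assms optimal_trigger_strategy optimal_positional_strategy by auto

end
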